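(* Let $A$ be a unital complex Banach algebra and let $C$ be a connected component of $E_p(A)$. Then $C$ is a relatively open subset of $E_p(A)$. Let $a_0,a_1\in C$. Then $a_0$ and $a_1$ are similar via a finite product of exponentials, i.e. $$a_1=e^{-c_m}\cdots e^{-c_1}a_0e^{c_1}\cdots e^{c_m}$$ for some integer $m\ge1$ and some $c_1,\dots,c_m\in A$. This gives an analytic path $a(t)\in C$, $t\in[0,1]$, from $a_0$ to $a_1$, namely $$a(t)=e^{-c_mt}\cdots e^{-c_1t}a_0e^{c_1t}\cdots e^{c_mt}.$$ Additionally, one may choose the $c_i$ so that $c_1^2=\dots=c_m^2=0$, which gives a polynomial path $$\tilde a(t)=e^{-c_mt}\cdots e^{-c_1t}a_0e^{c_1t}\cdots e^{c_mt}=(1-c_mt)\cdots(1-c_1t)\,a_0\,(1+c_1t)\cdots(1+c_mt),\quad t\in[0,1],$$ from $a_0$ to $a_1$; here (for a suitable choice) one of the two factors $1-c_1t$, $1+c_1t$ containing $c_1$ can be deleted without changing the value of the right-hand side of the last equation. Hence $C$ is pathwise connected via similarities with finite products of exponential functions, and also via polynomial paths; moreover, any two points of $C$ can be joined by a single path having both properties.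
   Context: All Banach algebras have a unit of norm $1$. Fix an integer $n\ge2$, distinct $\lambda_1,\dots,\lambda_n\in\mathbb C$, and let $p(\lambda)=\prod_{i=1}^n(\lambda-\lambda_i)$. For a unital complex Banach algebra $A$, $E_p(A)=\{a\in A\mid p(a)=0\}$, with the norm topology of $A$. A polynomial path is a path that is a polynomial function of $t$ with coefficients in $A$. *)

theory Defs
  imports "HOL-Analysis.Analysis" "HOL-Computational_Algebra.Polynomial"
begin

text \<open>The norm-one unit comes from the class \<open>real_normed_algebra_1\<close>; the complex structure
  is required to extend the given real one.\<close>

class complex_banach_algebra_1 = real_normed_algebra_1 + banach +
  fixes scaleC :: "complex \<Rightarrow> 'a \<Rightarrow> 'a"  (infixr "*\<^sub>C" 75)
  assumes scaleC_add_right: "z *\<^sub>C (x + y) = z *\<^sub>C x + z *\<^sub>C y"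
    and scaleC_add_left: "(z + w) *\<^sub>C x = z *\<^sub>C x + w *\<^sub>C x"
    and scaleC_scaleC: "z *\<^sub>C w *\<^sub>C x = (z * w) *\<^sub>C x"
    and scaleC_of_real: "complex_of_real r *\<^sub>C x = r *\<^sub>R x"
    and mult_scaleC_left: "(z *\<^sub>C x) * y = z *\<^sub>C (x * y)"
    and mult_scaleC_right: "x * (z *\<^sub>C y) = z *\<^sub>C (x * y)"
    and norm_scaleC: "norm (z *\<^sub>C x) = cmod z * norm x"

definition root_poly :: "nat \<Rightarrow> (nat \<Rightarrow> complex) \<Rightarrow> complex poly"
  where "root_poly n l = (\<Prod>i=1..n. [:- l i, 1:])"

definition poly_at :: "complex poly \<Rightarrow> 'a::complex_banach_algebra_1 \<Rightarrow> 'a"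
  where "poly_at p a = (\<Sum>k\<le>degree p. coeff p k *\<^sub>C a ^ k)"

definition zero_set :: "complex poly \<Rightarrow> 'a::complex_banach_algebra_1 set"
  where "zero_set p = {a. poly_at p a = 0}"

text \<open>A list \<open>[c\<^sub>1, \<dots>, c\<^sub>m]\<close> stands for the finite sequence of exponents. The algebra need not be
  commutative: the index increases to the right in the right-hand product and decreases in the
  left-hand one.\<close>

definition exp_conj :: "'a::complex_banach_algebra_1 list \<Rightarrow> 'a \<Rightarrow> 'a"
  where "exp_conj cs a =
    prod_list (map (\<lambda>c. exp (- c)) (rev cs)) * a * prod_list (map exp cs)"

definition exp_path :: "'a::complex_banach_algebra_1 list \<Rightarrow> 'a \<Rightarrow> real \<Rightarrow> 'a"
  where "exp_path cs a t = exp_conj (map (\<lambda>c. t *\<^sub>R c) cs) a"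

text \<open>Separate lists for the left and the right factors, so that a single factor can be omitted.\<close>

definition lin_path ::
    "'a::complex_banach_algebra_1 list \<Rightarrow> 'a list \<Rightarrow> 'a \<Rightarrow> real \<Rightarrow> 'a"
  where "lin_path ls rs a t =
    prod_list (map (\<lambda>c. 1 - t *\<^sub>R c) (rev ls)) * a * prod_list (map (\<lambda>c. 1 + t *\<^sub>R c) rs)"

definition joins_in :: "'a::topological_space set \<Rightarrow> 'a \<Rightarrow> 'a \<Rightarrow> (real \<Rightarrow> 'a) \<Rightarrow> bool"
  where "joins_in C a b g \<longleftrightarrow>
    path g \<and> path_image g \<subseteq> C \<and> pathstart g = a \<and> pathfinish g = b"

definition analytic_path :: "(real \<Rightarrow> 'a::real_normed_vector) \<Rightarrow> bool"
  where "analytic_path g \<longleftrightarrow> path g \<and>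
    (\<forall>s\<in>{0..1}. \<exists>r>0. \<exists>b :: nat \<Rightarrow> 'a. \<forall>t\<in>{0..1}. \<bar>t - s\<bar> < r \<longrightarrow>
      (\<lambda>k. (t - s) ^ k *\<^sub>R b k) sums g t)"

definition polynomial_path :: "(real \<Rightarrow> 'a::real_normed_vector) \<Rightarrow> bool"
  where "polynomial_path g \<longleftrightarrow> path g \<and>
    (\<exists>d. \<exists>b :: nat \<Rightarrow> 'a. \<forall>t\<in>{0..1}. g t = (\<Sum>k\<le>d. t ^ k *\<^sub>R b k))"

definition exp_similarity_path :: "(real \<Rightarrow> 'a::complex_banach_algebra_1) \<Rightarrow> bool"
  where "exp_similarity_path g \<longleftrightarrow> path g \<and>
    (\<exists>cs. cs \<noteq> [] \<and> (\<forall>t\<in>{0..1}. g t = exp_path cs (pathstart g) t))"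

end

theory Submission
  imports Defs
begin

text \<open>Write $p = \prod_i (\lambda - \lambda_i)$ and call $a$ and $b$ unipotently similar if one is carried to
  the other by conjugation with a finite product of factors $e^{c} = 1 + c$, $c^2 = 0$. The whole
  theorem follows from a local statement, \<open>nearby_zeros_similar\<close>: every zero $a$ of $p$ is
  unipotently similar to all zeros of $p$ close to it. Indeed, unipotent similarity is an equivalence
  relation, so by the local statement its classes are relatively open, and a connected
  component cannot meet two of them. Conversely, replacing each $c$ by $tc$ gives a path inside the
  zero set, so a class never leaves a component. Hence components and classes coincide
  (\<open>component_open_and_similar\<close>); openness and the connecting paths can be read off from this.

  For the local statement, Lagrange interpolation at the $\lambda_i$ turns a zero $a$ into a
  resolution of the identity $1 = \sum_i e_i$ by orthogonal idempotents with
  $a e_i = e_i a = \lambda_i e_i$ (\<open>spectral_idempotents\<close>). If $f_i$ are the idempotents of a second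
  zero $b$, the element $g = \sum_i e_i f_i$ satisfies $a g = g b$ and tends to $\sum_i e_i^2 = 1$ as
  $b \to a$. So $g$ is invertible for $b$ near $a$ and conjugates $a$ to $b$; it remains to
  replace it by a product of unipotents. Gaussian elimination does this: regarded as a block
  matrix with respect to the $e_i$, an element near $1$ has invertible pivots, and clearing the
  off-diagonal blocks writes $g = d u$ with $u$ a product of factors $1 + c$, $c^2 = 0$, and
  $d$ block diagonal (\<open>unipotent_factorization\<close>). A block diagonal $d$ commutes with every $e_i$,
  hence with $a = \sum_i \lambda_i e_i$, so it can be cancelled from $a d u = d u b$, leaving
  $a u = u b$.\<close>

section \<open>Polynomial calculus in a complex Banach algebra\<close>

lemma scaleC_zero_left [simp]: "0 *\<^sub>C x = (0::'a::complex_banach_algebra_1)"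
  using scaleC_of_real[of 0 x] by simp

lemma scaleC_one_left [simp]: "1 *\<^sub>C x = (x::'a::complex_banach_algebra_1)"
  using scaleC_of_real[of 1 x] by simp

lemma scaleC_zero_right [simp]: "z *\<^sub>C 0 = (0::'a::complex_banach_algebra_1)"
  using scaleC_add_right[of z 0 0] by simp

lemma scaleC_sum_right:
  "z *\<^sub>C sum f A = (\<Sum>i\<in>A. z *\<^sub>C (f i :: 'a::complex_banach_algebra_1))"
  by (induction A rule: infinite_finite_induct) (auto simp: scaleC_add_right)

lemma scaleC_left_cancel:
  fixes x :: "'a::complex_banach_algebra_1"
  assumes "z *\<^sub>C x = w *\<^sub>C x" "z \<noteq> w"
  shows "x = 0"
proof -
  have "z *\<^sub>C x = (z - w) *\<^sub>C x + w *\<^sub>C x"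
    by (simp flip: scaleC_add_left)
  with assms have "(z - w) *\<^sub>C x = 0" by simp
  then have "cmod (z - w) * norm x = 0"
    by (metis norm_scaleC norm_zero)
  with assms(2) show ?thesis by simp
qed

lemma poly_at_eq_sum:
  fixes a :: "'a::complex_banach_algebra_1"
  assumes "degree p \<le> d"
  shows "poly_at p a = (\<Sum>k\<le>d. coeff p k *\<^sub>C a ^ k)"
  unfolding poly_at_def
  by (rule sum.mono_neutral_left) (use assms in \<open>auto simp: coeff_eq_0\<close>)

lemma poly_at_0 [simp]: "poly_at 0 a = (0::'a::complex_banach_algebra_1)"
  by (simp add: poly_at_def)

lemma poly_at_1 [simp]: "poly_at 1 a = (1::'a::complex_banach_algebra_1)"
  by (simp add: poly_at_def)

lemma poly_at_pCons:
  "poly_at (pCons c p) a = c *\<^sub>C 1 + a * poly_at p (a::'a::complex_banach_algebra_1)"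
proof -
  have "poly_at (pCons c p) a = (\<Sum>k\<le>Suc (degree p). coeff (pCons c p) k *\<^sub>C a ^ k)"
    by (rule poly_at_eq_sum) (rule degree_pCons_le)
  also have "\<dots> = c *\<^sub>C 1 + (\<Sum>k\<le>degree p. a * (coeff p k *\<^sub>C a ^ k))"
    by (subst sum.atMost_Suc_shift) (simp add: mult_scaleC_right)
  finally show ?thesis
    by (simp add: poly_at_def sum_distrib_left)
qed

lemma poly_at_add:
  "poly_at (p + q) a = poly_at p a + poly_at q (a::'a::complex_banach_algebra_1)"
proof -
  let ?d = "max (degree p) (degree q)"
  have "degree (p + q) \<le> ?d" by (rule degree_add_le_max)
  then show ?thesis
    by (simp add: poly_at_eq_sum[where d = ?d] scaleC_add_left sum.distrib)
qed

lemma poly_at_smult: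
  "poly_at (smult c p) a = c *\<^sub>C poly_at p (a::'a::complex_banach_algebra_1)"
proof -
  have "poly_at (smult c p) a = (\<Sum>k\<le>degree p. coeff (smult c p) k *\<^sub>C a ^ k)"
    by (rule poly_at_eq_sum) (rule degree_smult_le)
  then show ?thesis
    by (simp add: poly_at_def scaleC_sum_right scaleC_scaleC)
qed

lemma poly_at_mult:
  "poly_at (p * q) a = poly_at p a * poly_at q (a::'a::complex_banach_algebra_1)"
proof (induction p)
  case (pCons c p)
  then show ?case
    by (simp add: poly_at_add poly_at_smult poly_at_pCons algebra_simps mult_scaleC_left)
qed simp

lemma poly_at_sum:
  "poly_at (\<Sum>i\<in>I. p i) a = (\<Sum>i\<in>I. poly_at (p i) (a::'a::complex_banach_algebra_1))"
  by (induction I rule: infinite_finite_induct) (auto simp: poly_at_add)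

lemma poly_at_linear: "poly_at [:- c, 1:] a = a - c *\<^sub>C (1::'a::complex_banach_algebra_1)"
proof -
  have "(- c) *\<^sub>C (1::'a) + c *\<^sub>C 1 = 0"
    by (simp flip: scaleC_add_left)
  then show ?thesis
    by (simp add: poly_at_pCons algebra_simps eq_neg_iff_add_eq_0)
qed

lemma poly_at_commute:
  "poly_at p a * poly_at q a = poly_at q a * poly_at p (a::'a::complex_banach_algebra_1)"
  by (metis mult.commute poly_at_mult)

lemma continuous_on_poly_at:
  "continuous_on S (poly_at p :: 'a::complex_banach_algebra_1 \<Rightarrow> 'a)"
proof -
  have "continuous_on S (\<lambda>a::'a. \<Sum>k\<le>degree p. (coeff p k *\<^sub>C 1) * a ^ k)"
    by (intro continuous_intros)
  moreover have "poly_at p = (\<lambda>a::'a. \<Sum>k\<le>degree p. (coeff p k *\<^sub>C 1) * a ^ k)"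
    by (auto simp: poly_at_def fun_eq_iff mult_scaleC_left)
  ultimately show ?thesis by simp
qed

lemma poly_at_conj:
  fixes a u v :: "'a::complex_banach_algebra_1"
  assumes "u * v = 1" "v * u = 1"
  shows "poly_at p (v * a * u) = v * poly_at p a * u"
proof (induction p)
  case (pCons c p)
  have "v * a * u * (v * poly_at p a * u) = v * a * (u * v) * poly_at p a * u"
    by (simp add: mult.assoc)
  with pCons assms show ?case
    by (simp add: poly_at_pCons distrib_left distrib_right mult.assoc
        mult_scaleC_left mult_scaleC_right)
qed simp

section \<open>Spectral idempotents of a zero\<close>

definition lagrange_poly :: "nat \<Rightarrow> (nat \<Rightarrow> complex) \<Rightarrow> nat \<Rightarrow> complex poly"
  where "lagrange_poly n l i =
    smult (inverse (\<Prod>j\<in>{1..n} - {i}. l i - l j)) (\<Prod>j\<in>{1..n} - {i}. [:- l j, 1:])"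

lemma linear_mult_lagrange_poly:
  assumes "i \<in> {1..n}"
  shows "[:- l i, 1:] * lagrange_poly n l i =
    smult (inverse (\<Prod>j\<in>{1..n} - {i}. l i - l j)) (root_poly n l)"
  unfolding lagrange_poly_def root_poly_def
  by (subst (3) prod.remove[of _ i]) (use assms in auto)

lemma poly_lagrange_poly:
  assumes "inj_on l {1..n}" "i \<in> {1..n}" "k \<in> {1..n}"
  shows "poly (lagrange_poly n l i) (l k) = (if i = k then 1 else 0)"
proof (cases "i = k")
  case True
  have "(\<Prod>j\<in>{1..n} - {i}. l i - l j) \<noteq> 0"
    using assms by (auto simp: prod_zero_iff dest: inj_onD)
  with True show ?thesis
    by (simp add: lagrange_poly_def poly_prod)
next
  case False
  with assms show ?thesis
    by (auto simp: lagrange_poly_def poly_prod prod_zero_iff)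
qed

text \<open>Both sides have degree less than the number of nodes and agree at the nodes.\<close>

lemma sum_lagrange_poly:
  assumes "n \<ge> 1" "inj_on l {1..n}"
  shows "(\<Sum>i=1..n. lagrange_poly n l i) = 1"
proof (rule poly_eqI_degree[where A = "l ` {1..n}"])
  fix x assume "x \<in> l ` {1..n}"
  then obtain k where k: "k \<in> {1..n}" "x = l k" by auto
  have "poly (\<Sum>i=1..n. lagrange_poly n l i) x = (\<Sum>i=1..n. if i = k then 1 else 0)"
    unfolding poly_sum k(2)
    by (rule sum.cong) (use poly_lagrange_poly[OF assms(2) _ k(1)] in auto)
  with k show "poly (\<Sum>i=1..n. lagrange_poly n l i) x = poly 1 x" by simp
next
  have "degree (lagrange_poly n l i) \<le> n - 1" if "i \<in> {1..n}" for i
  proof -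
    have "degree (\<Prod>j\<in>{1..n} - {i}. [:- l j, 1:]) \<le> sum (degree \<circ> (\<lambda>j. [:- l j, 1:])) ({1..n} - {i})"
      by (rule degree_prod_sum_le) simp
    also have "\<dots> = n - 1" using that by simp
    finally show ?thesis
      unfolding lagrange_poly_def using degree_smult_le order_trans by blast
  qed
  then have "degree (\<Sum>i=1..n. lagrange_poly n l i) \<le> n - 1"
    by (intro degree_sum_le) auto
  then show "degree (\<Sum>i=1..n. lagrange_poly n l i) < card (l ` {1..n})"
    using assms by (simp add: card_image)
qed (use assms in \<open>simp add: card_image\<close>)

text \<open>The eigenvalue equation comes from the divisibility of $(\lambda - \lambda_i) L_i$ by $p$. Everything
  else follows from it and from $\sum_i L_i = 1$: evaluating $e_i a e_j$ in two ways gives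
  orthogonality, and multiplying $1 = \sum_j e_j$ by $e_i$ gives idempotency.\<close>

lemma spectral_idempotents:
  fixes a :: "'a::complex_banach_algebra_1"
  assumes "n \<ge> 1" "inj_on l {1..n}" "a \<in> zero_set (root_poly n l)"
  defines "e \<equiv> \<lambda>i. poly_at (lagrange_poly n l i) a"
  shows "(\<Sum>i=1..n. e i) = 1"
    and "\<And>i. i \<in> {1..n} \<Longrightarrow> a * e i = l i *\<^sub>C e i"
    and "\<And>i. i \<in> {1..n} \<Longrightarrow> e i * a = l i *\<^sub>C e i"
    and "\<And>i j. i \<in> {1..n} \<Longrightarrow> j \<in> {1..n} \<Longrightarrow> i \<noteq> j \<Longrightarrow> e i * e j = 0"
    and "\<And>i. i \<in> {1..n} \<Longrightarrow> e i * e i = e i"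
proof -
  show sum: "(\<Sum>i=1..n. e i) = 1"
    using sum_lagrange_poly[OF assms(1,2)] unfolding e_def poly_at_sum[symmetric] by simp
  show ae: "a * e i = l i *\<^sub>C e i" if "i \<in> {1..n}" for i
  proof -
    have "poly_at ([:- l i, 1:] * lagrange_poly n l i) a = 0"
      unfolding linear_mult_lagrange_poly[OF that] poly_at_smult
      using assms(3) by (simp add: zero_set_def)
    then show ?thesis
      by (simp only: poly_at_mult poly_at_linear e_def)
        (simp add: algebra_simps mult_scaleC_left)
  qed
  have comm: "e i * a = a * e i" for i
    using poly_at_commute[of "[:0, 1:]" a "lagrange_poly n l i"]
    by (simp add: e_def poly_at_pCons)
  then show "e i * a = l i *\<^sub>C e i" if "i \<in> {1..n}" for i
    using ae[OF that] by simp
  show orth: "e i * e j = 0" if "i \<in> {1..n}" "j \<in> {1..n}" "i \<noteq> j" for i j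
  proof -
    have "l i *\<^sub>C (e i * e j) = e i * a * e j"
      by (simp add: comm ae[OF that(1)] mult_scaleC_left)
    also have "\<dots> = l j *\<^sub>C (e i * e j)"
      by (simp add: ae[OF that(2)] mult_scaleC_right mult.assoc)
    finally show ?thesis
      using that assms(2) by (auto intro: scaleC_left_cancel dest: inj_onD)
  qed
  show "e i * e i = e i" if "i \<in> {1..n}" for i
  proof -
    have "e i = e i * (\<Sum>j=1..n. e j)" by (simp only: sum mult_1_right)
    also have "\<dots> = e i * e i + (\<Sum>j\<in>{1..n}-{i}. e i * e j)"
      unfolding sum_distrib_left by (rule sum.remove) (use that in auto)
    also have "(\<Sum>j\<in>{1..n}-{i}. e i * e j) = 0"
      by (intro sum.neutral) (use orth that in auto)
    finally show ?thesis by simp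
  qed
qed

section \<open>Gaussian elimination near the identity\<close>

text \<open>The explicit bound on the inverse is what keeps the elimination steps below under control.\<close>

lemma neumann_inverse:
  fixes x :: "'a::{real_normed_algebra_1, banach}"
  assumes "norm x \<le> 1 / 2"
  obtains y where "(1 - x) * y = 1" "y * (1 - x) = 1" "norm y \<le> 2"
proof
  let ?y = "\<Sum>k. x ^ k"
  have "norm x < 1" using assms by linarith
  then have s: "summable (\<lambda>k. x ^ k)" by (rule complete_algebra_summable_geometric)
  have shift: "?y = 1 + (\<Sum>k. x ^ Suc k)"
    using suminf_split_initial_segment[OF s, of 1] by simp
  have "x * ?y = (\<Sum>k. x ^ Suc k)" using suminf_mult[OF s, of x] by simp
  with shift show "(1 - x) * ?y = 1" by (simp add: left_diff_distrib)
  have "?y * x = (\<Sum>k. x ^ Suc k)" using suminf_mult2[OF s, of x] by (simp add: power_commutes)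
  with shift show "?y * (1 - x) = 1" by (simp add: right_diff_distrib)
  have bound: "norm (x ^ k) \<le> (1 / 2) ^ k" for k
    using order_trans[OF norm_power_ineq power_mono[OF assms]] by simp
  have g: "summable (\<lambda>k. (1 / 2 :: real) ^ k)" by (simp add: summable_geometric)
  have sn: "summable (\<lambda>k. norm (x ^ k))"
    by (rule summable_comparison_test'[OF g, of 0]) (use bound in simp)
  have "norm ?y \<le> (\<Sum>k. norm (x ^ k))" by (rule summable_norm[OF sn])
  also have "\<dots> \<le> (\<Sum>k. (1 / 2 :: real) ^ k)" by (rule suminf_le[OF bound sn g])
  also have "\<dots> = 2" by (simp add: suminf_geometric)
  finally show "norm ?y \<le> 2" .
qed

lemma inverse_commute:
  fixes x y z :: "'a::monoid_mult"
  assumes "x * y = 1" "y * x = 1" "z * x = x * z"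
  shows "z * y = y * z"
proof -
  have "z * y = y * (x * z) * y" using assms(2) by (simp flip: mult.assoc)
  also have "\<dots> = y * z * (x * y)" by (simp only: assms(3)[symmetric] mult.assoc)
  also have "\<dots> = y * z" using assms(1) by simp
  finally show ?thesis .
qed

text \<open>One elimination step for the block decomposition belonging to \<open>e\<close>. Put $x = e(1-g)e$, so that
  $1 - x = ege + (1 - e)$; near the identity this has an inverse \<open>y\<close>, and $ye = ey$ inverts the
  pivot $ege$ in $eAe$. Subtracting the \<open>e\<close>-column times $c = yeg(1-e)$ from the other column
  clears the entry $eg(1-e)$. The element \<open>c\<close> lies in $eA(1-e)$, so its square vanishes. The last
  conclusion says that \<open>c\<close> lies in the bicommutant of \<open>{e, g}\<close>; it ensures that a later
  elimination does not destroy an earlier one.\<close>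

lemma eliminate_corner:
  fixes e :: "'a::{real_normed_algebra_1, banach}"
  assumes e: "e * e = e" and "\<epsilon> > 0"
  shows "\<exists>\<delta>>0. \<forall>g. norm (g - 1) < \<delta> \<longrightarrow> (\<exists>c. c * c = 0 \<and> c * e = 0 \<and>
      e * (g * (1 - c)) * (1 - e) = 0 \<and> norm (g * (1 - c) - 1) < \<epsilon> \<and>
      (\<forall>z. z * e = e * z \<and> z * g = g * z \<longrightarrow> z * c = c * z))"
proof -
  define K where "K = norm e * norm (1 - e)"
  define M where "M = norm e * norm e"
  \<comment> \<open>The second bound makes \<open>norm x \<le> 1/2\<close>; the third keeps \<open>g * (1 - c)\<close> within \<open>\<epsilon>\<close> of \<open>1\<close>.\<close>
  define \<delta> where "\<delta> = Min {1, 1 / (2 * (M + 1)), \<epsilon> / (2 + 4 * K)}"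
  have K: "K \<ge> 0" and M: "M \<ge> 0" by (auto simp: K_def M_def)
  have pos: "\<delta> > 0" using K M \<open>\<epsilon> > 0\<close> by (simp add: \<delta>_def)
  show ?thesis
  proof (intro exI[of _ \<delta>] conjI allI impI)
    show "\<delta> > 0" by (fact pos)
    fix g :: 'a assume g: "norm (g - 1) < \<delta>"
    define x where "x = e * (1 - g) * e"
    have d1: "\<delta> \<le> 1" and d2: "\<delta> \<le> 1 / (2 * (M + 1))" and d3: "\<delta> \<le> \<epsilon> / (2 + 4 * K)"
      by (auto simp: \<delta>_def)
    have "norm x \<le> norm e * norm (1 - g) * norm e"
      unfolding x_def by (meson mult_right_mono norm_ge_zero norm_mult_ineq order_trans)
    also have "\<dots> = M * norm (g - 1)" by (simp add: M_def norm_minus_commute)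
    also have "\<dots> \<le> M * \<delta>" using g M by (intro mult_left_mono) auto
    also have "\<dots> \<le> M * (1 / (2 * (M + 1)))" using d2 M by (intro mult_left_mono) auto
    also have "\<dots> \<le> 1 / 2" using M by (simp add: field_simps)
    finally obtain y where y: "(1 - x) * y = 1" "y * (1 - x) = 1" "norm y \<le> 2"
      by (rule neumann_inverse)
    \<comment> \<open>Since \<open>e * (1 - e) = 0\<close>, writing \<open>g - 1\<close> for \<open>g\<close> does not change \<open>c\<close> but shows that it is small.\<close>
    define c where "c = y * e * (g - 1) * (1 - e)"
    have ye: "e * y = y * e"
      by (rule inverse_commute[OF y(1,2)]) (simp add: x_def algebra_simps e, simp add: e flip: mult.assoc)
    have e0: "(1 - e) * e = 0" "e * (1 - e) = 0" by (simp_all add: e algebra_simps)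
    have ce: "c * e = 0" by (simp add: c_def mult.assoc e0)
    have ec: "e * c = c"
    proof -
      have "e * c = (e * y) * e * (g - 1) * (1 - e)" by (simp add: c_def mult.assoc)
      also have "\<dots> = y * (e * e) * (g - 1) * (1 - e)" by (simp add: ye mult.assoc)
      finally show ?thesis by (simp add: c_def e)
    qed
    have cc: "c * c = 0"
      by (metis ce ec mult.assoc mult_zero_left)
    have "e * (g * (1 - c)) * (1 - e) = 0"
    proof -
      have "e * g * c = e * g * e * c" by (metis ec mult.assoc)
      also have "e * g * e = e * (1 - x)"
        unfolding x_def by (simp add: algebra_simps e) (simp add: e flip: mult.assoc)
      also have "e * (1 - x) * c = e * ((1 - x) * y) * e * (g - 1) * (1 - e)"
        by (simp add: c_def mult.assoc)
      also have "\<dots> = e * (g - 1) * (1 - e)" by (simp add: y e)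
      also have "\<dots> = e * g * (1 - e)" by (simp add: right_diff_distrib left_diff_distrib e0 e)
      finally have *: "e * g * c = e * g * (1 - e)" .
      have "e * (g * (1 - c)) = e * g - e * g * c" by (simp add: algebra_simps)
      also have "\<dots> = e * g * e" unfolding * by (simp add: algebra_simps)
      finally have "e * (g * (1 - c)) * (1 - e) = e * g * (e * (1 - e))"
        by (simp only: mult.assoc)
      also have "\<dots> = 0" by (simp add: e0)
      finally show ?thesis .
    qed
    moreover have "norm (g * (1 - c) - 1) < \<epsilon>"
    proof -
      have "norm c \<le> norm y * norm e * norm (g - 1) * norm (1 - e)"
        unfolding c_def by (meson mult_right_mono norm_ge_zero norm_mult_ineq order_trans)
      also have "\<dots> = norm y * (K * norm (g - 1))" by (simp add: K_def)
      also have "\<dots> \<le> 2 * (K * norm (g - 1))" using y(3) K by (intro mult_right_mono) auto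
      finally have c: "norm c \<le> 2 * K * norm (g - 1)" by simp
      have "g = 1 + (g - 1)" by simp
      then have "norm g \<le> 1 + norm (g - 1)" by (metis norm_one norm_triangle_ineq)
      then have "norm g \<le> 2" using g d1 by simp
      have "g * (1 - c) - 1 = (g - 1) - g * c" by (simp add: algebra_simps)
      then have "norm (g * (1 - c) - 1) \<le> norm (g - 1) + norm (g * c)"
        by (metis norm_triangle_ineq4)
      also have "norm (g * c) \<le> norm g * norm c" by (rule norm_mult_ineq)
      also have "\<dots> \<le> 2 * (2 * K * norm (g - 1))"
        using c \<open>norm g \<le> 2\<close> by (intro mult_mono) auto
      also have "norm (g - 1) + 2 * (2 * K * norm (g - 1)) = (1 + 4 * K) * norm (g - 1)"
        by (simp add: algebra_simps)
      also have "\<dots> \<le> (1 + 4 * K) * \<delta>" using g K by (intro mult_left_mono) auto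
      also have "\<dots> < (2 + 4 * K) * \<delta>" using pos by simp
      also have "\<dots> \<le> \<epsilon>" using d3 K by (simp add: field_simps)
      finally show ?thesis by simp
    qed
    moreover have "z * c = c * z" if z: "z * e = e * z" "z * g = g * z" for z
    proof -
      have zg: "z * (g - 1) = (g - 1) * z" "z * (1 - g) = (1 - g) * z" "z * (1 - e) = (1 - e) * z"
        using z by (simp_all add: algebra_simps)
      have "z * x = x * z" unfolding x_def by (metis mult.assoc z(1) zg(2))
      then have "z * (1 - x) = (1 - x) * z" by (simp add: algebra_simps)
      then have "z * y = y * z" by (rule inverse_commute[OF y(1,2)])
      then show ?thesis unfolding c_def by (metis mult.assoc z(1) zg(1) zg(3))
    qed
    ultimately show "\<exists>c. c * c = 0 \<and> c * e = 0 \<and>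
        e * (g * (1 - c)) * (1 - e) = 0 \<and> norm (g * (1 - c) - 1) < \<epsilon> \<and>
        (\<forall>z. z * e = e * z \<and> z * g = g * z \<longrightarrow> z * c = c * z)"
      using cc ce by blast
  qed
qed

text \<open>Two elimination steps, with \<open>e\<close> and with \<open>1 - e\<close>, clear both off-diagonal corners. The second
  step multiplies by $1 - b$ with $b(1-e) = 0$ and therefore leaves the corner cleared by the
  first one untouched.\<close>

lemma block_diagonalize:
  fixes e :: "'a::{real_normed_algebra_1, banach}"
  assumes e: "e * e = e" and "\<epsilon> > 0"
  shows "\<exists>\<delta>>0. \<forall>g. norm (g - 1) < \<delta> \<longrightarrow> (\<exists>d b c. g = d * (1 + b) * (1 + c) \<and> b * b = 0 \<and> c * c = 0 \<and>
      e * d = d * e \<and> norm (d - 1) < \<epsilon> \<and>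
      (\<forall>z. z * e = e * z \<and> z * g = g * z \<longrightarrow> z * d = d * z))"
proof -
  have e': "(1 - e) * (1 - e) = 1 - e" by (simp add: algebra_simps e)
  obtain \<delta>' where d': "\<delta>' > 0"
    "\<And>g. norm (g - 1) < \<delta>' \<Longrightarrow> \<exists>c. c * c = 0 \<and> c * (1 - e) = 0 \<and>
      (1 - e) * (g * (1 - c)) * (1 - (1 - e)) = 0 \<and> norm (g * (1 - c) - 1) < \<epsilon> \<and>
      (\<forall>z. z * (1 - e) = (1 - e) * z \<and> z * g = g * z \<longrightarrow> z * c = c * z)"
    using eliminate_corner[OF e' \<open>\<epsilon> > 0\<close>] by blast
  obtain \<delta> where d: "\<delta> > 0"
    "\<And>g. norm (g - 1) < \<delta> \<Longrightarrow> \<exists>c. c * c = 0 \<and> c * e = 0 \<and>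
      e * (g * (1 - c)) * (1 - e) = 0 \<and> norm (g * (1 - c) - 1) < \<delta>' \<and>
      (\<forall>z. z * e = e * z \<and> z * g = g * z \<longrightarrow> z * c = c * z)"
    using eliminate_corner[OF e d'(1)] by blast
  show ?thesis
  proof (intro exI[of _ \<delta>] conjI allI impI)
    show "\<delta> > 0" by (fact d(1))
    fix g :: 'a assume "norm (g - 1) < \<delta>"
    from d(2)[OF this] obtain c where c: "c * c = 0" "e * (g * (1 - c)) * (1 - e) = 0"
      "norm (g * (1 - c) - 1) < \<delta>'"
      "\<And>z. z * e = e * z \<Longrightarrow> z * g = g * z \<Longrightarrow> z * c = c * z" by blast
    define h where "h = g * (1 - c)"
    from d'(2)[OF c(3)] obtain b where b: "b * b = 0" "b * (1 - e) = 0"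
      "(1 - e) * (h * (1 - b)) * e = 0" "norm (h * (1 - b) - 1) < \<epsilon>"
      "\<And>z. z * (1 - e) = (1 - e) * z \<Longrightarrow> z * h = h * z \<Longrightarrow> z * b = b * z"
      unfolding h_def by auto
    define d where "d = h * (1 - b)"
    have "(1 - b) * (1 + b) = 1" "(1 - c) * (1 + c) = 1"
      using b(1) c(1) by (simp_all add: algebra_simps)
    then have "g = d * (1 + b) * (1 + c)"
      unfolding d_def h_def by (simp add: mult.assoc) 
    moreover have "e * d = d * e"
    proof -
      have "e * d * (1 - e) = e * h * (1 - e) - e * h * (b * (1 - e))"
        by (simp add: d_def algebra_simps)
      also have "\<dots> = 0" using b(2) c(2) by (simp add: h_def)
      finally have "e * d - e * d * e = 0" by (simp only: right_diff_distrib mult_1_right)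
      moreover have "d * e - e * d * e = 0"
        using b(3) by (simp only: d_def[symmetric] left_diff_distrib mult_1_left)
      ultimately show ?thesis by simp
    qed
    moreover have "z * d = d * z" if z: "z * e = e * z" "z * g = g * z" for z
    proof -
      have "z * c = c * z" by (rule c(4)[OF z])
      then have "z * (1 - c) = (1 - c) * z" by (simp add: algebra_simps)
      then have zh: "z * h = h * z" unfolding h_def by (metis mult.assoc z(2))
      have "z * b = b * z" by (rule b(5)[OF _ zh]) (use z(1) in \<open>simp add: algebra_simps\<close>)
      then have "z * (1 - b) = (1 - b) * z" by (simp add: algebra_simps)
      then show ?thesis unfolding d_def by (metis mult.assoc zh)
    qed
    ultimately show "\<exists>d b c. g = d * (1 + b) * (1 + c) \<and> b * b = 0 \<and> c * c = 0 \<and>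
      e * d = d * e \<and> norm (d - 1) < \<epsilon> \<and>
      (\<forall>z. z * e = e * z \<and> z * g = g * z \<longrightarrow> z * d = d * z)"
      using b(1,4) c(1) d_def by blast
  qed
qed

text \<open>Induction on the set of idempotents: the diagonal part \<open>h\<close> for \<open>S\<close> is diagonalized once more with
  respect to the new idempotent \<open>e\<close>. The result still commutes with \<open>S\<close>, because it lies in the
  bicommutant of \<open>{e, h}\<close>.\<close>

lemma unipotent_factorization:
  fixes S :: "'a::{real_normed_algebra_1, banach} set"
  assumes "finite S" "\<And>e. e \<in> S \<Longrightarrow> e * e = e" "\<And>e f. e \<in> S \<Longrightarrow> f \<in> S \<Longrightarrow> e * f = f * e"
    "\<epsilon> > 0"
  shows "\<exists>\<delta>>0. \<forall>g. norm (g - 1) < \<delta> \<longrightarrow>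
    (\<exists>d cs. g = d * prod_list (map (\<lambda>c. 1 + c) cs) \<and> (\<forall>c\<in>set cs. c * c = 0) \<and>
      (\<forall>e\<in>S. e * d = d * e) \<and> norm (d - 1) < \<epsilon>)"
  using assms
proof (induction S arbitrary: \<epsilon> rule: finite_induct)
  case empty
  show ?case
  proof (intro exI[of _ \<epsilon>] conjI allI impI)
    fix g :: 'a assume "norm (g - 1) < \<epsilon>"
    then show "\<exists>d cs. g = d * prod_list (map (\<lambda>c. 1 + c) cs) \<and> (\<forall>c\<in>set cs. c * c = 0) \<and>
      (\<forall>e\<in>{}. e * d = d * e) \<and> norm (d - 1) < \<epsilon>"
      by (intro exI[of _ g] exI[of _ "[]"]) simp
  qed (fact empty)
next
  case (insert e S)
  obtain \<delta>' where d': "\<delta>' > 0"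
    "\<And>g. norm (g - 1) < \<delta>' \<Longrightarrow> \<exists>d b c. g = d * (1 + b) * (1 + c) \<and> b * b = 0 \<and> c * c = 0 \<and>
      e * d = d * e \<and> norm (d - 1) < \<epsilon> \<and>
      (\<forall>z. z * e = e * z \<and> z * g = g * z \<longrightarrow> z * d = d * z)"
    using block_diagonalize[of e \<epsilon>] insert.prems by blast
  have "\<exists>\<delta>>0. \<forall>g. norm (g - 1) < \<delta> \<longrightarrow>
    (\<exists>d cs. g = d * prod_list (map (\<lambda>c. 1 + c) cs) \<and> (\<forall>c\<in>set cs. c * c = 0) \<and>
      (\<forall>e\<in>S. e * d = d * e) \<and> norm (d - 1) < \<delta>')"
    by (rule insert.IH) (use insert.prems d'(1) in auto)
  then obtain \<delta> where d: "\<delta> > 0" "\<And>g. norm (g - 1) < \<delta> \<Longrightarrow>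
    \<exists>d cs. g = d * prod_list (map (\<lambda>c. 1 + c) cs) \<and> (\<forall>c\<in>set cs. c * c = 0) \<and>
      (\<forall>e\<in>S. e * d = d * e) \<and> norm (d - 1) < \<delta>'" by blast
  show ?case
  proof (intro exI[of _ \<delta>] conjI allI impI)
    fix g :: 'a assume "norm (g - 1) < \<delta>"
    from d(2)[OF this] obtain h cs where h: "g = h * prod_list (map (\<lambda>c. 1 + c) cs)"
      "\<forall>c\<in>set cs. c * c = 0" "\<forall>e\<in>S. e * h = h * e" "norm (h - 1) < \<delta>'" by blast
    from d'(2)[OF h(4)] obtain d b c where dbc: "h = d * (1 + b) * (1 + c)" "b * b = 0" "c * c = 0"
      "e * d = d * e" "norm (d - 1) < \<epsilon>"
      "\<And>z. z * e = e * z \<Longrightarrow> z * h = h * z \<Longrightarrow> z * d = d * z" by blast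
    have "g = d * prod_list (map (\<lambda>c. 1 + c) (b # c # cs))"
      by (simp add: h(1) dbc(1) mult.assoc)
    moreover have "\<forall>x\<in>set (b # c # cs). x * x = 0" using h(2) dbc(2,3) by simp
    moreover have "\<forall>x\<in>insert e S. x * d = d * x"
      using dbc(4,6) h(3) insert.prems(2) by auto
    ultimately show "\<exists>d cs. g = d * prod_list (map (\<lambda>c. 1 + c) cs) \<and> (\<forall>c\<in>set cs. c * c = 0) \<and>
      (\<forall>x\<in>insert e S. x * d = d * x) \<and> norm (d - 1) < \<epsilon>"
      using dbc(5) by blast
  qed (fact d(1))
qed

section \<open>Analyticity of exponential conjugation paths\<close>

text \<open>Requiring absolute convergence on the whole line makes the notion stable under products
  without any bookkeeping of radii.\<close>

definition entire_path :: "(real \<Rightarrow> 'a::real_normed_vector) \<Rightarrow> bool"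
  where "entire_path g \<longleftrightarrow> (\<forall>s. \<exists>b. \<forall>t.
    summable (\<lambda>k. norm ((t - s) ^ k *\<^sub>R b k)) \<and> (\<lambda>k. (t - s) ^ k *\<^sub>R b k) sums g t)"

lemma entire_path_const: "entire_path (\<lambda>t. a)"
  unfolding entire_path_def
proof (intro allI exI conjI)
  fix s t :: real
  let ?b = "\<lambda>k::nat. if k = 0 then a else 0"
  have z: "\<And>k. k \<notin> {0} \<Longrightarrow> (t - s) ^ k *\<^sub>R ?b k = 0" by simp
  show "summable (\<lambda>k. norm ((t - s) ^ k *\<^sub>R ?b k))"
    by (rule summable_finite[of "{0}"]) (use z in auto)
  show "(\<lambda>k. (t - s) ^ k *\<^sub>R ?b k) sums a"
    using sums_finite[of "{0}" "\<lambda>k. (t - s) ^ k *\<^sub>R ?b k"] by simp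
qed

lemma entire_path_mult:
  fixes f g :: "real \<Rightarrow> 'a::{real_normed_algebra, banach}"
  assumes "entire_path f" "entire_path g"
  shows "entire_path (\<lambda>t. f t * g t)"
  unfolding entire_path_def
proof
  fix s
  obtain u where u: "\<And>t. summable (\<lambda>k. norm ((t - s) ^ k *\<^sub>R u k))"
    "\<And>t. (\<lambda>k. (t - s) ^ k *\<^sub>R u k) sums f t"
    using assms(1) unfolding entire_path_def by metis
  obtain v where v: "\<And>t. summable (\<lambda>k. norm ((t - s) ^ k *\<^sub>R v k))"
    "\<And>t. (\<lambda>k. (t - s) ^ k *\<^sub>R v k) sums g t"
    using assms(2) unfolding entire_path_def by metis
  define w where "w k = (\<Sum>i\<le>k. u i * v (k - i))" for k
  have w: "(t - s) ^ k *\<^sub>R w k = (\<Sum>i\<le>k. ((t - s) ^ i *\<^sub>R u i) * ((t - s) ^ (k - i) *\<^sub>R v (k - i)))"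
    for t k
    unfolding w_def scaleR_sum_right
    by (rule sum.cong) (auto simp flip: power_add)
  have "summable (\<lambda>k. norm ((t - s) ^ k *\<^sub>R w k))" for t
  proof (rule summable_comparison_test')
    show "summable (\<lambda>k. \<Sum>i\<le>k. norm ((t - s) ^ i *\<^sub>R u i) * norm ((t - s) ^ (k - i) *\<^sub>R v (k - i)))"
      by (rule summable_Cauchy_product) (use u(1) v(1) in simp_all)
    show "norm (norm ((t - s) ^ k *\<^sub>R w k)) \<le>
      (\<Sum>i\<le>k. norm ((t - s) ^ i *\<^sub>R u i) * norm ((t - s) ^ (k - i) *\<^sub>R v (k - i)))" for k
      unfolding w real_norm_def abs_norm_cancel by (intro sum_norm_le norm_mult_ineq)
  qed
  moreover have "(\<lambda>k. (t - s) ^ k *\<^sub>R w k) sums (f t * g t)" for t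
    unfolding w using Cauchy_product_sums[OF u(1) v(1)] u(2) v(2) by (simp add: sums_iff)
  ultimately show "\<exists>b. \<forall>t. summable (\<lambda>k. norm ((t - s) ^ k *\<^sub>R b k)) \<and>
      (\<lambda>k. (t - s) ^ k *\<^sub>R b k) sums (f t * g t)" by blast
qed

lemma entire_path_exp:
  fixes c :: "'a::{real_normed_algebra_1, banach}"
  shows "entire_path (\<lambda>t. exp (t *\<^sub>R c))"
  unfolding entire_path_def
proof (intro allI exI conjI)
  fix s t :: real
  let ?b = "\<lambda>k. exp (s *\<^sub>R c) * (c ^ k /\<^sub>R fact k)"
  have b: "(t - s) ^ k *\<^sub>R ?b k = exp (s *\<^sub>R c) * (((t - s) *\<^sub>R c) ^ k /\<^sub>R fact k)" for k
    by (simp add: scaleR_power mult.commute)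
  show "summable (\<lambda>k. norm ((t - s) ^ k *\<^sub>R ?b k))"
    unfolding b
  proof (rule summable_comparison_test')
    show "summable (\<lambda>k. norm (exp (s *\<^sub>R c)) * norm (((t - s) *\<^sub>R c) ^ k /\<^sub>R fact k))"
      by (intro summable_mult summable_norm_exp)
    show "norm (norm (exp (s *\<^sub>R c) * (((t - s) *\<^sub>R c) ^ k /\<^sub>R fact k))) \<le>
      norm (exp (s *\<^sub>R c)) * norm (((t - s) *\<^sub>R c) ^ k /\<^sub>R fact k)" for k
      unfolding real_norm_def abs_norm_cancel by (rule norm_mult_ineq)
  qed
  \<comment> \<open>Expand at \<open>s\<close> by splitting off the factor \<open>exp (s *\<^sub>R c)\<close>, which commutes with the rest.\<close>
  have "exp (t *\<^sub>R c) = exp (s *\<^sub>R c + (t - s) *\<^sub>R c)" by (simp flip: scaleR_add_left)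
  also have "\<dots> = exp (s *\<^sub>R c) * exp ((t - s) *\<^sub>R c)" by (rule exp_add_commuting) simp
  finally show "(\<lambda>k. (t - s) ^ k *\<^sub>R ?b k) sums exp (t *\<^sub>R c)"
    unfolding b by (simp only: sums_mult exp_converges)
qed

lemma entire_path_prod_exp:
  fixes cs :: "'a::{real_normed_algebra_1, banach} list"
  shows "entire_path (\<lambda>t. prod_list (map (\<lambda>c. exp (t *\<^sub>R c)) cs))"
  by (induction cs) (auto intro: entire_path_const entire_path_mult entire_path_exp)

text \<open>Both sides of the conjugation as products of one-parameter groups, so that facts about such
  products apply to each of them.\<close>

lemma exp_path_eq:
  "exp_path cs a t = prod_list (map (\<lambda>c. exp (t *\<^sub>R c)) (map uminus (rev cs))) * a *
    prod_list (map (\<lambda>c. exp (t *\<^sub>R c)) (cs :: 'a::complex_banach_algebra_1 list))"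
  by (simp add: exp_path_def exp_conj_def rev_map comp_def)

lemma entire_path_exp_path:
  "entire_path (exp_path cs (a::'a::complex_banach_algebra_1))"
  unfolding exp_path_eq[abs_def]
  by (intro entire_path_mult entire_path_const entire_path_prod_exp)

lemma continuous_on_prod_exp:
  fixes cs :: "'a::{real_normed_algebra_1, banach} list"
  shows "continuous_on T (\<lambda>t. prod_list (map (\<lambda>c. exp (t *\<^sub>R c)) cs))"
proof (induction cs)
  case (Cons c cs)
  have "continuous_on T (\<lambda>t. exp (t *\<^sub>R c))"
    using exp_scaleR_has_vector_derivative_right
    by (rule continuous_on_vector_derivative)
  with Cons show ?case by (auto intro: continuous_intros)
qed simp

lemma path_exp_path: "path (exp_path cs (a::'a::complex_banach_algebra_1))"
  unfolding path_def exp_path_eq[abs_def]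
  by (intro continuous_intros continuous_on_prod_exp)

lemma analytic_path_exp_path: "analytic_path (exp_path cs (a::'a::complex_banach_algebra_1))"
proof -
  have "\<exists>r>0. \<exists>b :: nat \<Rightarrow> 'a. \<forall>t\<in>{0..1}. \<bar>t - s\<bar> < r \<longrightarrow>
      (\<lambda>k. (t - s) ^ k *\<^sub>R b k) sums exp_path cs a t" for s
    using entire_path_exp_path[of cs a] unfolding entire_path_def
    by (meson zero_less_one)
  then show ?thesis by (simp add: analytic_path_def path_exp_path)
qed

section \<open>Algebra of exponential conjugation\<close>

lemma exp_conj_Nil [simp]: "exp_conj [] a = (a::'a::complex_banach_algebra_1)"
  by (simp add: exp_conj_def)

lemma exp_conj_append:
  "exp_conj (xs @ ys) a = exp_conj ys (exp_conj xs (a::'a::complex_banach_algebra_1))"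
  by (simp add: exp_conj_def mult.assoc)

lemma exp_conj_Cons:
  "exp_conj (c # cs) a = exp_conj cs (exp (- c) * a * exp (c::'a::complex_banach_algebra_1))"
  by (simp add: exp_conj_def mult.assoc)

lemma exp_inverse_exp:
  "exp (- c) * exp c = (1::'a::{real_normed_algebra_1, banach})"
  using exp_minus_inverse[of "- c"] by simp

lemma exp_conj_inverse:
  "exp_conj (map uminus (rev cs)) (exp_conj cs a) = (a::'a::complex_banach_algebra_1)"
proof (induction cs arbitrary: a)
  case (Cons c cs)
  have "exp_conj [- c] (exp (- c) * a * exp c) = (exp c * exp (- c)) * a * (exp c * exp (- c))"
    by (simp add: exp_conj_def mult.assoc)
  also have "\<dots> = a" by (simp add: exp_minus_inverse)
  finally show ?case
    using Cons by (simp add: exp_conj_append exp_conj_Cons[of c cs])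
qed simp

lemma exp_conj_zero_set:
  fixes a :: "'a::complex_banach_algebra_1"
  assumes "a \<in> zero_set p"
  shows "exp_conj cs a \<in> zero_set p"
  using assms
proof (induction cs arbitrary: a)
  case (Cons c cs)
  have "exp (- c) * a * exp c \<in> zero_set p"
    using Cons.prems by (simp add: zero_set_def poly_at_conj exp_inverse_exp exp_minus_inverse)
  then show ?case using Cons.IH by (simp add: exp_conj_Cons)
qed simp

lemma exp_path_0 [simp]: "exp_path cs a 0 = (a::'a::complex_banach_algebra_1)"
proof -
  have "exp_conj (map (\<lambda>c. 0) cs) a = a" for cs :: "'a list"
    by (induction cs) (auto simp: exp_conj_Cons)
  then show ?thesis by (simp add: exp_path_def)
qed

lemma exp_path_1 [simp]: "exp_path cs a 1 = exp_conj cs (a::'a::complex_banach_algebra_1)"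
  by (simp add: exp_path_def)

section \<open>Square-zero exponents and polynomial paths\<close>

lemma exp_eq_1_plus:
  fixes c :: "'a::{real_normed_algebra_1, banach}"
  assumes "c * c = 0"
  shows "exp c = 1 + c"
proof -
  have "c ^ k /\<^sub>R fact k = 0" if "k \<notin> {0, 1}" for k
  proof -
    from that obtain m where "k = Suc (Suc m)" by (metis One_nat_def insertCI not0_implies_Suc)
    with assms show ?thesis by (simp flip: mult.assoc)
  qed
  then have "(\<lambda>k. c ^ k /\<^sub>R fact k) sums (\<Sum>k\<in>{0, 1}. c ^ k /\<^sub>R fact k)"
    by (intro sums_finite) auto
  with exp_converges[of c] show ?thesis by (simp add: sums_unique2)
qed

lemma exp_path_eq_lin_path:
  fixes cs :: "'a::complex_banach_algebra_1 list"
  assumes "\<forall>c\<in>set cs. c\<^sup>2 = 0"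
  shows "exp_path cs a t = lin_path cs cs a t"
proof -
  have "exp (t *\<^sub>R c) = 1 + t *\<^sub>R c" "exp (- (t *\<^sub>R c)) = 1 - t *\<^sub>R c" if "c \<in> set cs" for c
    using assms that exp_eq_1_plus[of "t *\<^sub>R c"] exp_eq_1_plus[of "- (t *\<^sub>R c)"]
    by (auto simp: power2_eq_square)
  then have "map (\<lambda>c. exp (t *\<^sub>R c)) cs = map (\<lambda>c. 1 + t *\<^sub>R c) cs"
    "map (\<lambda>c. exp (- (t *\<^sub>R c))) (rev cs) = map (\<lambda>c. 1 - t *\<^sub>R c) (rev cs)"
    by auto
  then show ?thesis
    unfolding exp_path_def exp_conj_def lin_path_def rev_map map_map comp_def by (simp only:)
qed

definition polynomial_fun :: "(real \<Rightarrow> 'a::real_vector) \<Rightarrow> bool"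
  where "polynomial_fun g \<longleftrightarrow> (\<exists>d. \<exists>b :: nat \<Rightarrow> 'a. \<forall>t. g t = (\<Sum>k\<le>d. t ^ k *\<^sub>R b k))"

lemma polynomial_fun_const: "polynomial_fun (\<lambda>t. a)"
  unfolding polynomial_fun_def by (intro exI[of _ 0] exI[of _ "\<lambda>k. a"]) simp

text \<open>Multiplication by a linear factor \<open>1 + t *\<^sub>R c\<close>, from the left or from the right; \<open>T\<close> stands
  for the corresponding multiplication by \<open>c\<close>.\<close>

lemma polynomial_fun_add_shift:
  assumes "polynomial_fun g" "linear T"
  shows "polynomial_fun (\<lambda>t. g t + t *\<^sub>R T (g t))"
proof -
  obtain d b where g: "\<And>t. g t = (\<Sum>k\<le>d. t ^ k *\<^sub>R b k)"
    using assms(1) unfolding polynomial_fun_def by blast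
  let ?b = "\<lambda>k. (if k \<le> d then b k else 0) + (if k = 0 then 0 else T (b (k - 1)))"
  have "g t + t *\<^sub>R T (g t) = (\<Sum>k\<le>Suc d. t ^ k *\<^sub>R ?b k)" for t
  proof -
    have "(\<Sum>k\<le>Suc d. t ^ k *\<^sub>R (if k \<le> d then b k else 0)) = g t"
      by (simp add: g)
    moreover have "(\<Sum>k\<le>Suc d. t ^ k *\<^sub>R (if k = 0 then 0 else T (b (k - 1)))) = t *\<^sub>R T (g t)"
      unfolding g linear_sum[OF assms(2)] linear_scale[OF assms(2)] scaleR_sum_right
      by (subst sum.atMost_Suc_shift) simp
    ultimately show ?thesis by (simp only: scaleR_add_right sum.distrib)
  qed
  then show ?thesis
    unfolding polynomial_fun_def by (intro exI[of _ "Suc d"] exI[of _ ?b] allI)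
qed

lemma polynomial_fun_mult_prod_linear:
  fixes g :: "real \<Rightarrow> 'a::real_algebra_1"
  assumes "polynomial_fun g"
  shows "polynomial_fun (\<lambda>t. g t * prod_list (map (\<lambda>c. 1 + t *\<^sub>R c) cs))"
  using assms
proof (induction cs arbitrary: g)
  case (Cons c cs)
  have "linear (\<lambda>x. x * c)" by (rule linearI) (simp_all add: distrib_right)
  from polynomial_fun_add_shift[OF Cons.prems this]
  have "polynomial_fun (\<lambda>t. g t * (1 + t *\<^sub>R c))" by (simp add: distrib_left)
  from Cons.IH[OF this] show ?case by (simp add: mult.assoc)
qed simp

lemma polynomial_fun_prod_linear_mult:
  fixes g :: "real \<Rightarrow> 'a::real_algebra_1"
  assumes "polynomial_fun g"
  shows "polynomial_fun (\<lambda>t. prod_list (map (\<lambda>c. 1 - t *\<^sub>R c) cs) * g t)"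
proof (induction cs)
  case (Cons c cs)
  have "linear (\<lambda>x. - c * x)" by (rule linearI) (simp_all add: distrib_left)
  from polynomial_fun_add_shift[OF Cons this]
  show ?case by (simp add: algebra_simps)
qed (use assms in simp)

lemma polynomial_fun_lin_path: "polynomial_fun (lin_path ls rs (a::'a::complex_banach_algebra_1))"
  unfolding lin_path_def[abs_def]
  by (intro polynomial_fun_mult_prod_linear polynomial_fun_prod_linear_mult polynomial_fun_const)

lemma polynomial_path_exp_path:
  fixes cs :: "'a::complex_banach_algebra_1 list"
  assumes "\<forall>c\<in>set cs. c\<^sup>2 = 0"
  shows "polynomial_path (exp_path cs a)"
proof -
  have "exp_path cs a = lin_path cs cs a"
    using exp_path_eq_lin_path[OF assms] by (rule ext)
  then have "polynomial_fun (exp_path cs a)" by (simp add: polynomial_fun_lin_path)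
  then show ?thesis
    unfolding polynomial_path_def polynomial_fun_def by (auto simp: path_exp_path)
qed

section \<open>Unipotent similarity of nearby zeros\<close>

definition unipotently_similar :: "'a::complex_banach_algebra_1 \<Rightarrow> 'a \<Rightarrow> bool"
  where "unipotently_similar a b \<longleftrightarrow> (\<exists>cs. cs \<noteq> [] \<and> (\<forall>c\<in>set cs. c\<^sup>2 = 0) \<and> b = exp_conj cs a)"

lemma unipotently_similar_sym:
  assumes "unipotently_similar a b"
  shows "unipotently_similar b a"
proof -
  obtain cs where cs: "cs \<noteq> []" "\<forall>c\<in>set cs. c\<^sup>2 = 0" "b = exp_conj cs a"
    using assms unfolding unipotently_similar_def by blast
  show ?thesis
    unfolding unipotently_similar_def
    by (intro exI[of _ "map uminus (rev cs)"]) (use cs in \<open>auto simp: exp_conj_inverse\<close>)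
qed

lemma unipotently_similar_trans:
  assumes "unipotently_similar a b" "unipotently_similar b c"
  shows "unipotently_similar a c"
proof -
  obtain cs ds where "cs \<noteq> []" "\<forall>c\<in>set cs. c\<^sup>2 = 0" "b = exp_conj cs a"
    "\<forall>c\<in>set ds. c\<^sup>2 = 0" "c = exp_conj ds b"
    using assms unfolding unipotently_similar_def by blast
  then show ?thesis
    unfolding unipotently_similar_def
    by (intro exI[of _ "cs @ ds"]) (auto simp: exp_conj_append)
qed

text \<open>The factor \<open>d\<close> of the intertwiner commutes with \<open>a\<close> and can be cancelled, and what remains is
  already a product of exponentials, since \<open>1 + c = exp c\<close> for square-zero \<open>c\<close>.\<close>

lemma unipotently_similar_if_intertwined:
  fixes a b d :: "'a::complex_banach_algebra_1"
  assumes cs: "\<forall>c\<in>set cs. c * c = 0"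
    and g: "g = d * prod_list (map (\<lambda>c. 1 + c) cs)" "a * g = g * b"
    and d: "a * d = d * a" "d' * d = 1"
  shows "unipotently_similar a b"
proof -
  define u where "u = prod_list (map exp cs)"
  have u: "prod_list (map (\<lambda>c. 1 + c) cs) = u"
    unfolding u_def using cs by (simp add: exp_eq_1_plus cong: map_cong)
  have inv: "prod_list (map (\<lambda>c. exp (- c)) (rev cs)) * u = 1"
  proof -
    have "exp_conj cs 1 = (1::'a)"
      by (induction cs) (simp_all add: exp_conj_Cons exp_inverse_exp)
    then show ?thesis by (simp add: exp_conj_def u_def)
  qed
  have "d * (a * u) = d * (u * b)"
    using g d(1) u by (metis mult.assoc)
  then have "a * u = u * b"
    using d(2) by (metis mult.assoc mult_1_left)
  then have "exp_conj cs a = b"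
    using inv by (simp add: exp_conj_def u_def mult.assoc flip: mult.assoc[of _ "prod_list (map exp cs)" b])
  \<comment> \<open>The exponent \<open>0\<close> makes the list nonempty.\<close>
  then have "b = exp_conj (0 # cs) a" by (simp add: exp_conj_Cons)
  then show ?thesis
    unfolding unipotently_similar_def
    by (intro exI[of _ "0 # cs"]) (use cs in \<open>simp add: power2_eq_square\<close>)
qed

text \<open>The intertwiner $g = \sum_i e_i f_i$ satisfies $a g = g b$ term by term, both sides being
  $\sum_i \lambda_i e_i f_i$. Its factorization with the tolerance \<open>1/2\<close> makes the block diagonal
  factor invertible by the Neumann series.\<close>

lemma nearby_zeros_similar:
  fixes a :: "'a::complex_banach_algebra_1"
  assumes "n \<ge> 1" "inj_on l {1..n}" "a \<in> zero_set (root_poly n l)"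
  obtains \<delta> where "\<delta> > 0"
    "\<And>b. b \<in> zero_set (root_poly n l) \<Longrightarrow> dist b a < \<delta> \<Longrightarrow> unipotently_similar a b"
proof -
  define e where "e i = poly_at (lagrange_poly n l i) a" for i
  note spec = spectral_idempotents[OF assms(1,2)]
  have ae: "a * e i = l i *\<^sub>C e i" "e i * a = l i *\<^sub>C e i" and ee: "e i * e i = e i"
    if "i \<in> {1..n}" for i
    unfolding e_def using spec(2,3,5)[OF assms(3) that] .
  have orth: "e i * e j = 0" if "i \<in> {1..n}" "j \<in> {1..n}" "i \<noteq> j" for i j
    unfolding e_def by (rule spec(4)[OF assms(3) that])
  have sum: "(\<Sum>i=1..n. e i) = 1"
    unfolding e_def by (rule spec(1)[OF assms(3)])
  have "\<exists>\<delta>>0. \<forall>g. norm (g - 1) < \<delta> \<longrightarrow>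
    (\<exists>d cs. g = d * prod_list (map (\<lambda>c. 1 + c) cs) \<and> (\<forall>c\<in>set cs. c * c = 0) \<and>
      (\<forall>x\<in>e ` {1..n}. x * d = d * x) \<and> norm (d - 1) < 1 / 2)"
  proof (rule unipotent_factorization)
    show "x * y = y * x" if "x \<in> e ` {1..n}" "y \<in> e ` {1..n}" for x y
      using that unfolding e_def by (auto intro: poly_at_commute)
  qed (use ee in auto)
  then obtain \<eta> where "\<eta> > 0" and \<eta>: "\<And>g. norm (g - 1) < \<eta> \<Longrightarrow>
    \<exists>d cs. g = d * prod_list (map (\<lambda>c. 1 + c) cs) \<and> (\<forall>c\<in>set cs. c * c = 0) \<and>
      (\<forall>x\<in>e ` {1..n}. x * d = d * x) \<and> norm (d - 1) < 1 / 2" by blast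
  \<comment> \<open>The intertwiner of \<open>a\<close> and \<open>b\<close>, as a function of \<open>b\<close> so that continuity at \<open>a\<close> can be used.\<close>
  define G where "G b = (\<Sum>i=1..n. e i * poly_at (lagrange_poly n l i) b)" for b
  have "G a = (\<Sum>i=1..n. e i)"
    unfolding G_def e_def[symmetric] by (intro sum.cong refl ee)
  then have "G a = 1" by (simp only: sum)
  have "continuous_on UNIV G"
    unfolding G_def[abs_def] by (intro continuous_intros continuous_on_poly_at)
  then obtain \<delta> where "\<delta> > 0" and \<delta>: "\<And>b. dist b a < \<delta> \<Longrightarrow> dist (G b) (G a) < \<eta>"
    using \<open>\<eta> > 0\<close> unfolding continuous_on_iff by (metis UNIV_I)
  show ?thesis
  proof (rule that[OF \<open>\<delta> > 0\<close>])
    fix b assume b: "b \<in> zero_set (root_poly n l)" "dist b a < \<delta>"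
    from \<delta>[OF b(2)] have "norm (G b - 1) < \<eta>" by (simp add: \<open>G a = 1\<close> dist_norm)
    from \<eta>[OF this] obtain d cs where dcs: "G b = d * prod_list (map (\<lambda>c. 1 + c) cs)"
      "\<forall>c\<in>set cs. c * c = 0" "\<forall>i\<in>{1..n}. e i * d = d * e i" "norm (d - 1) < 1 / 2" by auto
    have "a * G b = G b * b"
      unfolding G_def sum_distrib_left sum_distrib_right
    proof (rule sum.cong[OF refl])
      fix i assume i: "i \<in> {1..n}"
      let ?f = "poly_at (lagrange_poly n l i) b"
      have "a * (e i * ?f) = l i *\<^sub>C (e i * ?f)"
        by (simp add: ae(1)[OF i] mult_scaleC_left flip: mult.assoc)
      also have "\<dots> = e i * ?f * b"
        by (simp add: spec(3)[OF b(1) i] mult_scaleC_right mult.assoc)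
      finally show "a * (e i * ?f) = e i * ?f * b" .
    qed
    moreover have "a * d = d * a"
    proof -
      have "a = (\<Sum>i=1..n. a * e i)" by (simp only: sum mult_1_right flip: sum_distrib_left)
      also have "\<dots> = (\<Sum>i=1..n. l i *\<^sub>C e i)" by (intro sum.cong refl ae(1))
      finally have a: "a = (\<Sum>i=1..n. l i *\<^sub>C e i)" .
      have "(\<Sum>i=1..n. l i *\<^sub>C e i) * d = d * (\<Sum>i=1..n. l i *\<^sub>C e i)"
        unfolding sum_distrib_left sum_distrib_right
        by (rule sum.cong[OF refl])
          (use dcs(3) in \<open>simp add: mult_scaleC_left mult_scaleC_right\<close>)
      then show ?thesis by (simp only: a[symmetric])
    qed
    moreover obtain d' where "d' * d = 1"
    proof -
      have "norm (1 - d) \<le> 1 / 2" using dcs(4) by (simp add: norm_minus_commute)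
      then obtain y where "y * (1 - (1 - d)) = 1" by (rule neumann_inverse)
      with that show ?thesis by simp
    qed
    ultimately show "unipotently_similar a b"
      using unipotently_similar_if_intertwined[OF dcs(2,1)] by blast
  qed
qed

section \<open>Components of the zero set\<close>

text \<open>Conjugation does not leave the zero set, so the path is a connected subset of it through \<open>a\<close> and
  stays in the component of \<open>a\<close>.\<close>

lemma joins_in_exp_path:
  fixes a b :: "'a::complex_banach_algebra_1"
  assumes "C \<in> components (zero_set p)" "a \<in> C" "b = exp_conj cs a"
  shows "joins_in C a b (exp_path cs a)"
proof -
  have "a \<in> zero_set p" using assms(1,2) in_components_subset by blast
  then have "path_image (exp_path cs a) \<subseteq> zero_set p"
    by (auto simp: path_image_def exp_path_def exp_conj_zero_set)
  moreover have "a \<in> path_image (exp_path cs a)"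
    unfolding path_image_def by (rule image_eqI[of _ _ 0]) auto
  then have "C \<inter> path_image (exp_path cs a) \<noteq> {}" using assms(2) by blast
  ultimately have "path_image (exp_path cs a) \<subseteq> C"
    by (intro components_maximal[OF assms(1)] connected_path_image path_exp_path)
  then show ?thesis
    by (simp add: joins_in_def path_exp_path pathstart_def pathfinish_def assms(3))
qed

text \<open>The classes of unipotent similarity are open in the connected set \<open>C\<close>, so there is only one.
  Near a point of \<open>C\<close> all zeros belong to its class, which lies in \<open>C\<close>; this is openness.\<close>

lemma component_open_and_similar:
  fixes C :: "'a::complex_banach_algebra_1 set"
  assumes "n \<ge> 1" "inj_on l {1..n}" "C \<in> components (zero_set (root_poly n l))"
  shows "openin (top_of_set (zero_set (root_poly n l))) C"
    and "\<And>a b. a \<in> C \<Longrightarrow> b \<in> C \<Longrightarrow> unipotently_similar a b"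
proof -
  let ?E = "zero_set (root_poly n l) :: 'a set"
  have CE: "C \<subseteq> ?E" using assms(3) by (rule in_components_subset)
  have near: "\<exists>\<delta>>0. \<forall>b\<in>?E. dist b a < \<delta> \<longrightarrow> unipotently_similar a b" if "a \<in> C" for a
  proof -
    have "a \<in> ?E" using that CE by blast
    from nearby_zeros_similar[OF assms(1,2) this] show ?thesis by metis
  qed
  have stays: "b \<in> C" if a: "a \<in> C" and ab: "unipotently_similar a b" for a b
  proof -
    obtain cs where "b = exp_conj cs a"
      using ab unfolding unipotently_similar_def by blast
    from joins_in_exp_path[OF assms(3) a this] show ?thesis
      unfolding joins_in_def using pathfinish_in_path_image[of "exp_path cs a"] by auto
  qed
  show "openin (top_of_set ?E) C"
    unfolding openin_euclidean_subtopology_iff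
  proof (intro conjI ballI CE)
    fix a assume "a \<in> C"
    from near[OF this] obtain \<delta> where "\<delta> > 0" "\<forall>b\<in>?E. dist b a < \<delta> \<longrightarrow> unipotently_similar a b"
      by blast
    with stays[OF \<open>a \<in> C\<close>] show "\<exists>\<delta>>0. \<forall>b\<in>?E. dist b a < \<delta> \<longrightarrow> b \<in> C" by auto
  qed
  show "unipotently_similar a b" if "a \<in> C" "b \<in> C" for a b
    using in_components_connected[OF assms(3)] that
  proof (rule connected_equivalence_relation)
    show "unipotently_similar y x" if "unipotently_similar x y" for x y :: 'a
      by (rule unipotently_similar_sym[OF that])
    show "unipotently_similar x z"
      if "unipotently_similar x y" "unipotently_similar y z" for x y z :: 'a
      by (rule unipotently_similar_trans[OF that])
    fix x assume x: "x \<in> C"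
    then obtain \<delta> where "\<delta> > 0" "\<forall>y\<in>?E. dist y x < \<delta> \<longrightarrow> unipotently_similar x y"
      using near by blast
    then show "\<exists>T. openin (top_of_set C) T \<and> x \<in> T \<and> (\<forall>y\<in>T. unipotently_similar x y)"
      using x CE by (intro exI[of _ "C \<inter> ball x \<delta>"]) (auto simp: openin_open_Int dist_commute)
  qed
qed

theorem theorem7:
  fixes n :: nat and l :: "nat \<Rightarrow> complex" and C :: "'a::complex_banach_algebra_1 set"
  assumes "n \<ge> 2"
    and "inj_on l {1..n}"
    and "C \<in> components (zero_set (root_poly n l))"
  shows "openin (top_of_set (zero_set (root_poly n l))) C \<and>
    (\<forall>a0\<in>C. \<forall>a1\<in>C.
      (\<exists>cs. cs \<noteq> [] \<and> a1 = exp_conj cs a0) \<and>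
      (\<forall>cs. cs \<noteq> [] \<and> a1 = exp_conj cs a0 \<longrightarrow>
        analytic_path (exp_path cs a0) \<and> joins_in C a0 a1 (exp_path cs a0)) \<and>
      (\<exists>cs. cs \<noteq> [] \<and> (\<forall>c\<in>set cs. c\<^sup>2 = 0) \<and> a1 = exp_conj cs a0 \<and>
        ((\<forall>t\<in>{0..1}. lin_path cs cs a0 t = lin_path (tl cs) cs a0 t) \<or>
         (\<forall>t\<in>{0..1}. lin_path cs cs a0 t = lin_path cs (tl cs) a0 t))) \<and>
      (\<forall>cs. cs \<noteq> [] \<and> (\<forall>c\<in>set cs. c\<^sup>2 = 0) \<and> a1 = exp_conj cs a0 \<longrightarrow>
        (\<forall>t\<in>{0..1}. exp_path cs a0 t = lin_path cs cs a0 t) \<and>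
        polynomial_path (exp_path cs a0) \<and> joins_in C a0 a1 (exp_path cs a0))) \<and>
    path_connected C \<and>
    (\<forall>a0\<in>C. \<forall>a1\<in>C. \<exists>g. joins_in C a0 a1 g \<and> exp_similarity_path g) \<and>
    (\<forall>a0\<in>C. \<forall>a1\<in>C. \<exists>g. joins_in C a0 a1 g \<and> polynomial_path g) \<and>
    (\<forall>a0\<in>C. \<forall>a1\<in>C. \<exists>g. joins_in C a0 a1 g \<and> exp_similarity_path g \<and> polynomial_path g)"
proof -
  have "n \<ge> 1" using assms(1) by simp
  note comp = component_open_and_similar[OF this assms(2,3)]
  note joins = joins_in_exp_path[OF assms(3)]
  have similar: "\<exists>cs. cs \<noteq> [] \<and> (\<forall>c\<in>set cs. c\<^sup>2 = 0) \<and> a1 = exp_conj cs a0"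
    if "a0 \<in> C" "a1 \<in> C" for a0 a1
    using comp(2)[OF that] by (simp add: unipotently_similar_def)
  have delete: "\<exists>cs. cs \<noteq> [] \<and> (\<forall>c\<in>set cs. c\<^sup>2 = 0) \<and> a1 = exp_conj cs a0 \<and>
      (\<forall>t\<in>{0..1}. lin_path cs cs a0 t = lin_path (tl cs) cs a0 t)"
    if a: "a0 \<in> C" "a1 \<in> C" for a0 a1
  proof -
    obtain cs where "\<forall>c\<in>set cs. c\<^sup>2 = 0" "a1 = exp_conj cs a0"
      using similar[OF a] by blast
    \<comment> \<open>Deleting the left factor of the first exponent requires \<open>c\<^sub>1 * a0 = 0\<close>, since the other factors are
    invertible, and deleting the right one requires \<open>a0 * c\<^sub>1 = 0\<close>. If \<open>0\<close> is not one of the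
    \<open>l i\<close>, then \<open>a0\<close> is invertible, so the choice \<open>c\<^sub>1 = 0\<close> is forced.\<close>
    then show ?thesis
      by (intro exI[of _ "0 # cs"]) (simp add: exp_conj_Cons lin_path_def)
  qed
  have path: "\<exists>g. joins_in C a0 a1 g \<and> exp_similarity_path g \<and> polynomial_path g"
    if a: "a0 \<in> C" "a1 \<in> C" for a0 a1
  proof -
    obtain cs where cs: "cs \<noteq> []" "\<forall>c\<in>set cs. c\<^sup>2 = 0" "a1 = exp_conj cs a0"
      using similar[OF a] by blast
    then have "exp_similarity_path (exp_path cs a0)"
      by (auto simp: exp_similarity_path_def path_exp_path pathstart_def)
    with joins[OF a(1) cs(3)] polynomial_path_exp_path[OF cs(2)] show ?thesis by blast
  qed
  have pconn: "path_connected C"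
    unfolding path_connected_def
  proof (intro ballI)
    fix a0 a1 assume "a0 \<in> C" "a1 \<in> C"
    from path[OF this] show "\<exists>g. path g \<and> path_image g \<subseteq> C \<and> pathstart g = a0 \<and> pathfinish g = a1"
      unfolding joins_in_def by auto
  qed
  show ?thesis
  proof (intro conjI ballI allI impI)
    fix a0 a1 assume a: "a0 \<in> C" "a1 \<in> C"
    show "\<exists>cs. cs \<noteq> [] \<and> a1 = exp_conj cs a0" using similar[OF a] by auto
    show "\<exists>cs. cs \<noteq> [] \<and> (\<forall>c\<in>set cs. c\<^sup>2 = 0) \<and> a1 = exp_conj cs a0 \<and>
        ((\<forall>t\<in>{0..1}. lin_path cs cs a0 t = lin_path (tl cs) cs a0 t) \<or>
         (\<forall>t\<in>{0..1}. lin_path cs cs a0 t = lin_path cs (tl cs) a0 t))"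
      using delete[OF a] by blast
    show "\<exists>g. joins_in C a0 a1 g \<and> exp_similarity_path g" using path[OF a] by auto
    show "\<exists>g. joins_in C a0 a1 g \<and> polynomial_path g" using path[OF a] by auto
    show "\<exists>g. joins_in C a0 a1 g \<and> exp_similarity_path g \<and> polynomial_path g" by (rule path[OF a])
    fix cs assume cs: "cs \<noteq> [] \<and> a1 = exp_conj cs a0"
    show "analytic_path (exp_path cs a0)" by (rule analytic_path_exp_path)
    show "joins_in C a0 a1 (exp_path cs a0)" using cs a by (intro joins) auto
  next
    fix a0 a1 cs assume a: "a0 \<in> C" "a1 \<in> C"
      and cs: "cs \<noteq> [] \<and> (\<forall>c\<in>set cs. c\<^sup>2 = 0) \<and> a1 = exp_conj cs a0"
    show "joins_in C a0 a1 (exp_path cs a0)" using cs a by (intro joins) auto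
    show "polynomial_path (exp_path cs a0)" using cs by (intro polynomial_path_exp_path) auto
    show "exp_path cs a0 t = lin_path cs cs a0 t" for t
      using cs by (intro exp_path_eq_lin_path) auto
  qed (fact comp(1) pconn)+
qed

end
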